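(* Fix $t>0$ and basis functions $\psi_1,\dots,\psi_N$. Let the data $x_1,\dots,x_T$, $y_1,\dots,y_T$ be generated from the SDE in one of the following two ways, and suppose that there is a constant $\tilde\gamma>0$, not depending on $T$, such that for all $f,g\in\{\psi_1,\dots,\psi_N\}$ the corresponding bound holds: (i) (independent sampling) the $x_k$ are i.i.d. with law $\mu$, each $y_k$ is a realisation of $X_t^{x_k}$, with the pairs $(x_k,y_k)$ independent, and $$\mathbb{E}_{x\sim\mu}\bigl[g(x)^2\,\mathrm{Var}_W[f(X_t^{x})]\bigr]\le\tilde\gamma;$$ (ii) (Markov chain sampling) $x_1\in\mathcal{M}$ is a known point, $x_{k+1}=X_t^{x_k}$ and $y_k=x_{k+1}$ (so the data are a sample path of the SDE observed with time step $t$), and for every $k\ge1$ $$\mathbb{E}\bigl[g(x_k)^2\,v_f(x_k)\bigr]\le\tilde\gamma,\qquad v_f(x):=\mathrm{Var}_W[f(X_t^{x})].$$ Define the $N\times N$ matrices $$K_{\mu_T}=\frac1T\bigl(\mathcal{K}^t\psi(\mathbf{X})\bigr)\psi(\mathbf{X})^{\intercal},\qquad \hat K_T=\frac1T\psi(\mathbf{Y})\psi(\mathbf{X})^{\intercal}.$$ Then, taking expectations over the distributions of $\mathbf{X}$ and $\mathbf{Y}$, $$\mathbb{E}_{\mathbf{X}}[K_{\mu_T}]=\mathbb{E}_{\mathbf{X},\mathbf{Y}}[\hat K_T].$$ Further, there exists $\gamma>0$, independent of $T$, such that $$\mathbb{E}_{\mathbf{X},\mathbf{Y}}\bigl\|K_{\mu_T}-\hat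 K_T\bigr\|_F^2\le\gamma\,T^{-1}.$$
   Context: Setting: $\mathcal{M}\subset\mathbb{R}$ is the state space of the one-dimensional autonomous SDE $\mathrm{d}X_t = a(X_t;\theta)\,\mathrm{d}t + b(X_t;\theta)\,\mathrm{d}W_t$ with a fixed parameter $\theta$, where $W$ is a standard Brownian motion and $a,b$ are such that a strong solution exists for all relevant initial conditions. $X_t^x$ denotes the solution at time $t$ started at $X_0=x$. The notation $x_{k+1}=X_t^{x_k}$ means that, conditionally on the past $x_1,\dots,x_k$, the point $x_{k+1}$ has the law of $X_t^{x}$ with $x=x_k$ (driven by fresh Brownian increments). $\mathbb{E}_W$ and $\mathrm{Var}_W$ denote expectation and variance over the Brownian motion. The time-$t$ Koopman operator acts on measurable functions $g:\mathcal{M}\to\mathbb{R}$ with $g(X_t^x)$ integrable by $\mathcal{K}^tg(x)=\mathbb{E}_W[g(X_t^x)]$. The measure $\mu$ is a probability measure on $\mathcal{M}$. The basis functions $\psi_1,\dots,\psi_N:\mathcal{M}\to\mathbb{R}$ are linearly independent and belong to a subspace of $L^2(\mathcal{M},\mu)$ that is invariant under all $\mathcal{K}^t$, $t\ge0$. In the Markov chain case, the entries of $K_{\mu_T}$ and $\hat K_T$ are understood to be integrable, so that their expectations exist. Notation: $\psi(x)=[\psi_1(x),\dots,\psi_N(x)]^{\intercal}$; $\mathbf{X}=[x_1,\dots,x_T]$, $\mathbf{Y}=[y_1,\dots,y_T]$; $\psi(\mathbf{X})=[\psi(x_1),\dots,\psi(x_T)]$, $\psi(\mathbf{Y})=[\psi(y_1),\dots,\psi(y_T)]$,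 and $\mathcal{K}^t\psi(\mathbf{X})=[\mathcal{K}^t\psi(x_1),\dots,\mathcal{K}^t\psi(x_T)]$ (with $\mathcal{K}^t$ applied componentwise) are $N\times T$ matrices. $\|A\|_F^2=\sum_{i,j}|A_{i,j}|^2$ is the squared Frobenius norm. *)

theory Defs
  imports "HOL-Probability.Probability"
begin

section \<open>Brownian motion and the Ito integral\<close>

definition brownian_motion :: "'o measure \<Rightarrow> (real \<Rightarrow> 'o \<Rightarrow> real) \<Rightarrow> bool" where
  "brownian_motion \<Omega> W \<longleftrightarrow>
     prob_space \<Omega> \<and>
     (\<forall>s\<ge>0. W s \<in> borel_measurable \<Omega>) \<and>
     (\<forall>\<omega>\<in>space \<Omega>. W 0 \<omega> = 0) \<and>
     (\<forall>\<omega>\<in>space \<Omega>. continuous_on {0..} (\<lambda>s. W s \<omega>)) \<and>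
     (\<forall>r s. 0 \<le> r \<and> r < s \<longrightarrow>
        distributed \<Omega> lborel (\<lambda>\<omega>. W s \<omega> - W r \<omega>) (normal_density 0 (sqrt (s - r)))) \<and>
     (\<forall>n (\<tau> :: nat \<Rightarrow> real). 0 \<le> \<tau> 0 \<and> (\<forall>i<n. \<tau> i \<le> \<tau> (Suc i)) \<longrightarrow>
        prob_space.indep_vars \<Omega> (\<lambda>_. borel) (\<lambda>i \<omega>. W (\<tau> (Suc i)) \<omega> - W (\<tau> i) \<omega>) {..<n})"

text \<open>The filtration of \<open>W\<close>, augmented by the null sets.\<close>

definition brownian_filtration :: "'o measure \<Rightarrow> (real \<Rightarrow> 'o \<Rightarrow> real) \<Rightarrow> real \<Rightarrow> 'o measure" where
  "brownian_filtration \<Omega> W s =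
     sigma (space \<Omega>) ({W r -` A \<inter> space \<Omega> | r A. 0 \<le> r \<and> r \<le> s \<and> A \<in> sets borel} \<union> null_sets \<Omega>)"

definition converges_in_prob_0 :: "'o measure \<Rightarrow> (nat \<Rightarrow> 'o \<Rightarrow> ennreal) \<Rightarrow> bool" where
  "converges_in_prob_0 \<Omega> Z \<longleftrightarrow>
     (\<forall>\<epsilon>>0. (\<lambda>m. measure \<Omega> {\<omega>\<in>space \<Omega>. ennreal \<epsilon> < Z m \<omega>}) \<longlonglongrightarrow> 0)"

text \<open>
  The triple \<open>(n, \<tau>, \<xi>)\<close> encodes the simple process that equals \<open>\<xi> i\<close> on \<open>(\<tau> i, \<tau> (i + 1)]\<close>
  for \<open>i < n\<close> and vanishes elsewhere.
\<close>

type_synonym 'o simple_process = "nat \<times> (nat \<Rightarrow> real) \<times> (nat \<Rightarrow> 'o \<Rightarrow> real)"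

definition simple_adapted :: "'o measure \<Rightarrow> (real \<Rightarrow> 'o \<Rightarrow> real) \<Rightarrow> 'o simple_process \<Rightarrow> bool" where
  "simple_adapted \<Omega> W = (\<lambda>(n, \<tau>, \<xi>).
     0 \<le> \<tau> 0 \<and> (\<forall>i<n. \<tau> i \<le> \<tau> (Suc i)) \<and>
     (\<forall>i<n. \<xi> i \<in> borel_measurable (brownian_filtration \<Omega> W (\<tau> i)) \<and>
            (\<exists>C. \<forall>\<omega>\<in>space \<Omega>. \<bar>\<xi> i \<omega>\<bar> \<le> C)))"

definition simple_value :: "'o simple_process \<Rightarrow> real \<Rightarrow> 'o \<Rightarrow> real" where
  "simple_value = (\<lambda>(n, \<tau>, \<xi>) r \<omega>. \<Sum>i<n. \<xi> i \<omega> * indicator {\<tau> i<..\<tau> (Suc i)} r)"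

definition simple_ito :: "(real \<Rightarrow> 'o \<Rightarrow> real) \<Rightarrow> 'o simple_process \<Rightarrow> real \<Rightarrow> 'o \<Rightarrow> real" where
  "simple_ito W = (\<lambda>(n, \<tau>, \<xi>) s \<omega>.
     \<Sum>i<n. \<xi> i \<omega> * (W (min s (\<tau> (Suc i))) \<omega> - W (min s (\<tau> i)) \<omega>))"

text \<open>
  \<open>I\<close> is a version of the Ito integral of \<open>H\<close> against \<open>W\<close> over \<open>[0, s]\<close>. Convergence in
  probability, rather than in mean square, covers every adapted integrand whose square is almost
  surely integrable in time.
\<close>

definition is_ito_integral ::
  "'o measure \<Rightarrow> (real \<Rightarrow> 'o \<Rightarrow> real) \<Rightarrow> (real \<Rightarrow> 'o \<Rightarrow> real) \<Rightarrow> real \<Rightarrow> ('o \<Rightarrow> real) \<Rightarrow> bool" where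
  "is_ito_integral \<Omega> W H s I \<longleftrightarrow>
     I \<in> borel_measurable \<Omega> \<and>
     (\<exists>S. (\<forall>m. simple_adapted \<Omega> W (S m)) \<and>
        converges_in_prob_0 \<Omega>
          (\<lambda>m \<omega>. \<integral>\<^sup>+r\<in>{0..s}. ennreal ((simple_value (S m) r \<omega> - H r \<omega>)\<^sup>2) \<partial>lborel) \<and>
        converges_in_prob_0 \<Omega> (\<lambda>m \<omega>. ennreal \<bar>simple_ito W (S m) s \<omega> - I \<omega>\<bar>))"

section \<open>Solutions of the SDE\<close>

definition strong_solution ::
  "'o measure \<Rightarrow> (real \<Rightarrow> 'o \<Rightarrow> real) \<Rightarrow> real set \<Rightarrow> (real \<Rightarrow> real) \<Rightarrow> (real \<Rightarrow> real) \<Rightarrow> real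
    \<Rightarrow> (real \<Rightarrow> 'o \<Rightarrow> real) \<Rightarrow> bool" where
  "strong_solution \<Omega> W M \<alpha> \<beta> x Y \<longleftrightarrow>
     (\<forall>s\<ge>0. Y s \<in> brownian_filtration \<Omega> W s \<rightarrow>\<^sub>M restrict_space borel M) \<and>
     (\<forall>\<omega>\<in>space \<Omega>. continuous_on {0..} (\<lambda>s. Y s \<omega>)) \<and>
     (\<forall>s\<ge>0.
        (AE \<omega> in \<Omega>. set_integrable lborel {0..s} (\<lambda>r. \<alpha> (Y r \<omega>)) \<and>
                   set_integrable lborel {0..s} (\<lambda>r. (\<beta> (Y r \<omega>))\<^sup>2)) \<and>
        (\<exists>I. is_ito_integral \<Omega> W (\<lambda>r \<omega>. \<beta> (Y r \<omega>)) s I \<and>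
             (AE \<omega> in \<Omega>. Y s \<omega> = x + (LINT r:{0..s}|lborel. \<alpha> (Y r \<omega>)) + I \<omega>)))"

text \<open>\<open>X s x \<omega>\<close> is the value at time \<open>s\<close> of the solution started at \<open>x\<close>.\<close>

definition sde_solutions ::
  "'o measure \<Rightarrow> (real \<Rightarrow> 'o \<Rightarrow> real) \<Rightarrow> real set \<Rightarrow> (real \<Rightarrow> 'p \<Rightarrow> real) \<Rightarrow> (real \<Rightarrow> 'p \<Rightarrow> real) \<Rightarrow> 'p
    \<Rightarrow> (real \<Rightarrow> real \<Rightarrow> 'o \<Rightarrow> real) \<Rightarrow> bool" where
  "sde_solutions \<Omega> W M a b \<theta> X \<longleftrightarrow>
     brownian_motion \<Omega> W \<and>
     M \<in> sets borel \<and>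
     (\<lambda>x. a x \<theta>) \<in> borel_measurable (restrict_space borel M) \<and>
     (\<lambda>x. b x \<theta>) \<in> borel_measurable (restrict_space borel M) \<and>
     (\<forall>x\<in>M. strong_solution \<Omega> W M (\<lambda>z. a z \<theta>) (\<lambda>z. b z \<theta>) x (\<lambda>s. X s x))"

definition transition_law ::
  "'o measure \<Rightarrow> real set \<Rightarrow> (real \<Rightarrow> real \<Rightarrow> 'o \<Rightarrow> real) \<Rightarrow> real \<Rightarrow> real \<Rightarrow> real measure" where
  "transition_law \<Omega> M X s x = distr \<Omega> (restrict_space borel M) (X s x)"

section \<open>The Koopman operator\<close>

definition koopman ::
  "'o measure \<Rightarrow> (real \<Rightarrow> real \<Rightarrow> 'o \<Rightarrow> real) \<Rightarrow> real \<Rightarrow> (real \<Rightarrow> real) \<Rightarrow> real \<Rightarrow> real" where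
  "koopman \<Omega> X s g x = (\<integral>\<omega>. g (X s x \<omega>) \<partial>\<Omega>)"

text \<open>
  The variance of \<open>g (X s x)\<close> over the Brownian motion. It is \<open>ennreal\<close>-valued because the Bochner
  integral would assign variance 0 to a variable that is not square integrable; here the value is
  \<open>\<infinity>\<close> in that case.
\<close>

definition koopman_var ::
  "'o measure \<Rightarrow> (real \<Rightarrow> real \<Rightarrow> 'o \<Rightarrow> real) \<Rightarrow> real \<Rightarrow> (real \<Rightarrow> real) \<Rightarrow> real \<Rightarrow> ennreal" where
  "koopman_var \<Omega> X s g x = (\<integral>\<^sup>+\<omega>. ennreal ((g (X s x \<omega>) - koopman \<Omega> X s g x)\<^sup>2) \<partial>\<Omega>)"

text \<open>
  Subspaces of \<open>L\<^sup>2(\<mu>)\<close> are represented by sets of functions; the Koopman image of a member only has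
  to agree \<open>\<mu>\<close>-almost everywhere with a member.
\<close>

definition koopman_invariant_L2_subspace ::
  "'o measure \<Rightarrow> (real \<Rightarrow> real \<Rightarrow> 'o \<Rightarrow> real) \<Rightarrow> real measure \<Rightarrow> (real \<Rightarrow> real) set \<Rightarrow> bool" where
  "koopman_invariant_L2_subspace \<Omega> X \<mu> V \<longleftrightarrow>
     (\<forall>f\<in>V. f \<in> borel_measurable \<mu> \<and> integrable \<mu> (\<lambda>x. (f x)\<^sup>2)) \<and>
     (\<lambda>_. 0) \<in> V \<and>
     (\<forall>f\<in>V. \<forall>g\<in>V. (\<lambda>x. f x + g x) \<in> V) \<and>
     (\<forall>c. \<forall>f\<in>V. (\<lambda>x. c * f x) \<in> V) \<and>
     (\<forall>s\<ge>0. \<forall>f\<in>V. (AE x in \<mu>. integrable \<Omega> (\<lambda>\<omega>. f (X s x \<omega>))) \<and>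
                   (\<exists>h\<in>V. AE x in \<mu>. koopman \<Omega> X s f x = h x))"

definition lin_indep_on :: "real set \<Rightarrow> ('n::finite \<Rightarrow> real \<Rightarrow> real) \<Rightarrow> bool" where
  "lin_indep_on M \<psi> \<longleftrightarrow> (\<forall>c. (\<forall>x\<in>M. (\<Sum>i\<in>UNIV. c i * \<psi> i x) = 0) \<longrightarrow> (\<forall>i. c i = 0))"

section \<open>The data\<close>

text \<open>Conditionally on the sub-sigma-algebra \<open>F\<close>, the variable \<open>Y\<close> has the random law \<open>\<kappa>\<close>.\<close>

definition has_cond_law ::
  "'w measure \<Rightarrow> 'w measure \<Rightarrow> ('w \<Rightarrow> real) \<Rightarrow> ('w \<Rightarrow> real measure) \<Rightarrow> real set \<Rightarrow> bool" where
  "has_cond_law D F Y \<kappa> M \<longleftrightarrow>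
     (\<forall>A\<in>sets (restrict_space borel M).
        AE \<omega> in D. real_cond_exp D F (\<lambda>\<omega>'. indicator A (Y \<omega>')) \<omega> = measure (\<kappa> \<omega>) A)"

definition iid_sampling ::
  "'o measure \<Rightarrow> real set \<Rightarrow> (real \<Rightarrow> real \<Rightarrow> 'o \<Rightarrow> real) \<Rightarrow> real \<Rightarrow> real measure \<Rightarrow> nat
    \<Rightarrow> 'w measure \<Rightarrow> (nat \<Rightarrow> 'w \<Rightarrow> real) \<Rightarrow> (nat \<Rightarrow> 'w \<Rightarrow> real) \<Rightarrow> bool" where
  "iid_sampling \<Omega> M X t \<mu> T D x y \<longleftrightarrow>
     prob_space D \<and>
     (\<forall>k\<in>{1..T}.
        x k \<in> D \<rightarrow>\<^sub>M restrict_space borel M \<and>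
        y k \<in> D \<rightarrow>\<^sub>M restrict_space borel M \<and>
        distr D (restrict_space borel M) (x k) = \<mu> \<and>
        has_cond_law D (vimage_algebra (space D) (x k) (restrict_space borel M)) (y k)
          (\<lambda>\<omega>. transition_law \<Omega> M X t (x k \<omega>)) M) \<and>
     prob_space.indep_vars D (\<lambda>_. restrict_space borel M \<Otimes>\<^sub>M restrict_space borel M)
       (\<lambda>k \<omega>. (x k \<omega>, y k \<omega>)) {1..T}"

text \<open>The chain has \<open>T + 1\<close> points, since \<open>y T\<close> is \<open>x (T + 1)\<close>.\<close>

definition markov_sampling ::
  "'o measure \<Rightarrow> real set \<Rightarrow> (real \<Rightarrow> real \<Rightarrow> 'o \<Rightarrow> real) \<Rightarrow> real \<Rightarrow> real \<Rightarrow> nat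
    \<Rightarrow> 'w measure \<Rightarrow> (nat \<Rightarrow> 'w \<Rightarrow> real) \<Rightarrow> (nat \<Rightarrow> 'w \<Rightarrow> real) \<Rightarrow> bool" where
  "markov_sampling \<Omega> M X t x1 T D x y \<longleftrightarrow>
     prob_space D \<and>
     x1 \<in> M \<and>
     (\<forall>k\<in>{1..T+1}. x k \<in> D \<rightarrow>\<^sub>M restrict_space borel M) \<and>
     (\<forall>\<omega>\<in>space D. x 1 \<omega> = x1) \<and>
     (\<forall>k\<in>{1..T}.
        has_cond_law D
          (vimage_algebra (space D) (\<lambda>\<omega>. \<lambda>i\<in>{1..k}. x i \<omega>) (\<Pi>\<^sub>M i\<in>{1..k}. restrict_space borel M))
          (x (k + 1)) (\<lambda>\<omega>. transition_law \<Omega> M X t (x k \<omega>)) M \<and>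
        (\<forall>\<omega>\<in>space D. y k \<omega> = x (k + 1) \<omega>))"

section \<open>The matrices\<close>

text \<open>
  Matrices of size \<open>N \<times> T\<close> have rows indexed by the finite type \<open>'n\<close> with \<open>N = CARD('n)\<close> and columns
  by \<open>1, \<dots>, T\<close>; \<open>avg_mult_transpose T A B\<close> is \<open>A B\<^sup>T / T\<close>, where the superscript denotes transposition.
\<close>

definition avg_mult_transpose ::
  "nat \<Rightarrow> ('n \<Rightarrow> nat \<Rightarrow> real) \<Rightarrow> ('n \<Rightarrow> nat \<Rightarrow> real) \<Rightarrow> real^'n^'n" where
  "avg_mult_transpose T A B = (\<chi> i j. 1 / real T * (\<Sum>k=1..T. A i k * B j k))"

definition K_mu ::
  "'o measure \<Rightarrow> (real \<Rightarrow> real \<Rightarrow> 'o \<Rightarrow> real) \<Rightarrow> real \<Rightarrow> ('n \<Rightarrow> real \<Rightarrow> real) \<Rightarrow> nat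
    \<Rightarrow> (nat \<Rightarrow> 'w \<Rightarrow> real) \<Rightarrow> 'w \<Rightarrow> real^'n^'n" where
  "K_mu \<Omega> X t \<psi> T x \<omega> =
     avg_mult_transpose T (\<lambda>i k. koopman \<Omega> X t (\<psi> i) (x k \<omega>)) (\<lambda>i k. \<psi> i (x k \<omega>))"

definition K_hat ::
  "('n \<Rightarrow> real \<Rightarrow> real) \<Rightarrow> nat \<Rightarrow> (nat \<Rightarrow> 'w \<Rightarrow> real) \<Rightarrow> (nat \<Rightarrow> 'w \<Rightarrow> real) \<Rightarrow> 'w \<Rightarrow> real^'n^'n" where
  "K_hat \<psi> T x y \<omega> = avg_mult_transpose T (\<lambda>i k. \<psi> i (y k \<omega>)) (\<lambda>i k. \<psi> i (x k \<omega>))"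

definition frobenius_sq :: "real^'n^'m \<Rightarrow> real" where
  "frobenius_sq A = (\<Sum>i\<in>UNIV. \<Sum>j\<in>UNIV. \<bar>A $ i $ j\<bar>\<^sup>2)"

end

theory Submission
  imports Defs
begin

text \<open>
  Entrywise, \<open>K_mu - K_hat\<close> is the average over \<open>k\<close> of the summands
  \<open>(\<K>\<^sup>t f(x\<^sub>k) - f(y\<^sub>k)) g(x\<^sub>k)\<close>. Given the past, \<open>y\<^sub>k\<close> has the transition law started at \<open>x\<^sub>k\<close>, so each
  summand has conditional mean zero and second moment \<open>E[g(x\<^sub>k)\<^sup>2 v\<^sub>f(x\<^sub>k)]\<close>, which is bounded by hypothesis.
  Distinct summands are orthogonal in \<open>L\<^sup>2\<close>, by independence under i.i.d. sampling and as martingale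
  differences along the chain, so the average has second moment of order \<open>1/T\<close>. Summing over the entries
  gives \<open>\<gamma> = N\<^sup>2 \<gamma>'\<close>.
\<close>

lemma nn_integral_cond_law:
  fixes Y :: "'w \<Rightarrow> real" and h :: "'w \<times> real \<Rightarrow> ennreal"
  assumes D: "prob_space D" and F: "subalgebra D F"
    and Y [measurable]: "Y \<in> D \<rightarrow>\<^sub>M restrict_space borel M"
    and \<kappa>: "\<kappa> \<in> F \<rightarrow>\<^sub>M prob_algebra (restrict_space borel M)"
    and law: "has_cond_law D F Y \<kappa> M"
    and h [measurable]: "h \<in> borel_measurable (F \<Otimes>\<^sub>M restrict_space borel M)"
  shows "(\<integral>\<^sup>+\<omega>. h (\<omega>, Y \<omega>) \<partial>D) = (\<integral>\<^sup>+\<omega>. (\<integral>\<^sup>+z. h (\<omega>, z) \<partial>\<kappa> \<omega>) \<partial>D)"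
proof -
  interpret prob_space D by fact
  interpret finite_measure_subalgebra D F
    by (simp add: F finite_measure_axioms finite_measure_subalgebra.intro finite_measure_subalgebra_axioms.intro)
  let ?S = "restrict_space borel M :: real measure"
  let ?P = "distr D (F \<Otimes>\<^sub>M ?S) (\<lambda>\<omega>. (\<omega>, Y \<omega>))"
  let ?k = "\<lambda>\<omega>. distr (\<kappa> \<omega>) (F \<Otimes>\<^sub>M ?S) (Pair \<omega>)"
  have id: "(\<lambda>\<omega>. \<omega>) \<in> D \<rightarrow>\<^sub>M F"
    by (rule measurable_from_subalg[OF F]) simp
  note [measurable] = id
  have \<kappa>_prob: "prob_space (\<kappa> \<omega>)" and sets_\<kappa> [simp]: "sets (\<kappa> \<omega>) = sets ?S" if "\<omega> \<in> space D" for \<omega>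
    using measurable_space[OF \<kappa>, of \<omega>] that F by (auto simp: space_prob_algebra subalgebra_def)
  have "?k \<in> F \<rightarrow>\<^sub>M subprob_algebra (F \<Otimes>\<^sub>M ?S)"
    by (rule measurable_distr2[OF _ measurable_prob_algebraD[OF \<kappa>]]) simp
  then have k [measurable]: "?k \<in> D \<rightarrow>\<^sub>M subprob_algebra (F \<Otimes>\<^sub>M ?S)"
    by (rule measurable_from_subalg[OF F])
  have \<kappa>D [measurable]: "\<kappa> \<in> D \<rightarrow>\<^sub>M prob_algebra ?S"
    by (rule measurable_from_subalg[OF F \<kappa>])
  have rect: "emeasure ?P (A \<times> B) = emeasure (D \<bind> ?k) (A \<times> B)"
    if A: "A \<in> sets F" and B [measurable]: "B \<in> sets ?S" for A B
  proof -
    have A' [measurable]: "A \<in> sets D" using A F by (auto simp: subalgebra_def)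
    have Bi [measurable]: "(\<lambda>\<omega>. indicator B (Y \<omega>) :: real) \<in> borel_measurable D" by measurable
    have int: "integrable D (\<lambda>\<omega>. indicator B (Y \<omega>) :: real)"
      by (rule integrable_const_bound[of _ 1]) (auto simp: indicator_def)
    have "(\<lambda>\<omega>. (\<omega>, Y \<omega>)) -` (A \<times> B) \<inter> space D = A \<inter> (Y -` B \<inter> space D)"
      using sets.sets_into_space[OF A'] by auto
    then have "emeasure ?P (A \<times> B) = emeasure D (A \<inter> (Y -` B \<inter> space D))"
      using A by (subst emeasure_distr) auto
    also have "\<dots> = ennreal (LINT \<omega>:A|D. indicator B (Y \<omega>))"
    proof -
      have "(LINT \<omega>:A|D. indicator B (Y \<omega>)) = (LINT \<omega>|D. indicat_real (A \<inter> (Y -` B \<inter> space D)) \<omega>)"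
        unfolding set_lebesgue_integral_def
        by (intro Bochner_Integration.integral_cong) (auto simp: indicator_def)
      moreover have "A \<inter> (Y -` B \<inter> space D) \<in> sets D" by measurable
      ultimately show ?thesis
        by (simp add: emeasure_eq_measure Int_assoc)
    qed
    also have "(LINT \<omega>:A|D. indicator B (Y \<omega>)) = (LINT \<omega>:A|D. measure (\<kappa> \<omega>) B)"
      unfolding real_cond_exp_intA[OF int A]
      using law B unfolding has_cond_law_def set_lebesgue_integral_def
      by (intro integral_cong_AE) auto
    also have "ennreal \<dots> = (\<integral>\<^sup>+\<omega>. ennreal (indicator A \<omega> * measure (\<kappa> \<omega>) B) \<partial>D)"
      unfolding set_lebesgue_integral_def real_scaleR_def
      by (intro nn_integral_eq_integral[symmetric] integrable_const_bound[of _ 1])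
         (auto simp: indicator_def intro!: prob_space.prob_le_1 \<kappa>_prob)
    also have "\<dots> = (\<integral>\<^sup>+\<omega>. emeasure (?k \<omega>) (A \<times> B) \<partial>D)"
    proof (intro nn_integral_cong)
      fix \<omega> assume \<omega>: "\<omega> \<in> space D"
      interpret p: prob_space "\<kappa> \<omega>" by (rule \<kappa>_prob[OF \<omega>])
      have m: "Pair \<omega> \<in> \<kappa> \<omega> \<rightarrow>\<^sub>M F \<Otimes>\<^sub>M ?S"
        using \<omega> F by (simp add: subalgebra_def measurable_cong_sets[OF sets_\<kappa>[OF \<omega>] refl])
      have "Pair \<omega> -` (A \<times> B) \<inter> space (\<kappa> \<omega>) = (if \<omega> \<in> A then B else {})"
        using sets.sets_into_space[OF B] sets_eq_imp_space_eq[OF sets_\<kappa>[OF \<omega>]] by auto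
      then show "ennreal (indicator A \<omega> * measure (\<kappa> \<omega>) B) = emeasure (?k \<omega>) (A \<times> B)"
        using A by (subst emeasure_distr[OF m]) (auto simp: p.emeasure_eq_measure)
    qed
    also have "\<dots> = emeasure (D \<bind> ?k) (A \<times> B)"
      by (rule emeasure_bind[OF not_empty k, symmetric]) (use A in auto)
    finally show ?thesis .
  qed
  have sets_bind: "sets (D \<bind> ?k) = sets (F \<Otimes>\<^sub>M ?S)"
    by (rule sets_bind_measurable[OF k not_empty])
  interpret P: prob_space ?P by (rule prob_space_distr) measurable
  have eq: "?P = D \<bind> ?k"
  proof (rule measure_eqI_generator_eq[OF Int_stable_pair_measure_generator pair_measure_closed,
        where A="\<lambda>_. space F \<times> space ?S"])
    fix R assume "R \<in> {a \<times> b | a b. a \<in> sets F \<and> b \<in> sets ?S}"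
    then obtain A B where "R = A \<times> B" "A \<in> sets F" "B \<in> sets ?S" by blast
    then show "emeasure ?P R = emeasure (D \<bind> ?k) R" by (simp only: rect)
  next
    show "sets ?P = sigma_sets (space F \<times> space ?S) {a \<times> b | a b. a \<in> sets F \<and> b \<in> sets ?S}"
      by (simp only: sets_distr sets_pair_measure)
    show "sets (D \<bind> ?k) = sigma_sets (space F \<times> space ?S) {a \<times> b | a b. a \<in> sets F \<and> b \<in> sets ?S}"
      by (simp only: sets_bind sets_pair_measure)
  qed (use P.emeasure_finite in auto)
  have "(\<integral>\<^sup>+\<omega>. h (\<omega>, Y \<omega>) \<partial>D) = integral\<^sup>N ?P h"
    by (simp add: nn_integral_distr)
  also have "\<dots> = (\<integral>\<^sup>+\<omega>. integral\<^sup>N (?k \<omega>) h \<partial>D)"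
    unfolding eq by (rule nn_integral_bind[OF h k])
  also have "\<dots> = (\<integral>\<^sup>+\<omega>. (\<integral>\<^sup>+z. h (\<omega>, z) \<partial>\<kappa> \<omega>) \<partial>D)"
    by (intro nn_integral_cong nn_integral_distr)
       (use F in \<open>auto simp: subalgebra_def measurable_cong_sets[OF sets_\<kappa> refl]\<close>)
  finally show ?thesis .
qed

lemma nn_integral_pos_eq_neg:
  fixes g :: "'a \<Rightarrow> real"
  assumes "integrable N g" "integral\<^sup>L N g = 0"
  shows "(\<integral>\<^sup>+z. ennreal (g z) \<partial>N) = (\<integral>\<^sup>+z. ennreal (- g z) \<partial>N)"
  using assms by (auto simp: real_lebesgue_integral_def real_integrable_def ennreal_enn2real_if
      less_top[symmetric] dest: arg_cong[where f=ennreal])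

lemma integral_cond_law_centered:
  fixes Y c m :: "'w \<Rightarrow> real" and f :: "real \<Rightarrow> real"
  assumes D: "prob_space D" and F: "subalgebra D F"
    and Y [measurable]: "Y \<in> D \<rightarrow>\<^sub>M restrict_space borel M"
    and \<kappa>: "\<kappa> \<in> F \<rightarrow>\<^sub>M prob_algebra (restrict_space borel M)"
    and law: "has_cond_law D F Y \<kappa> M"
    and [measurable]: "c \<in> borel_measurable F" "m \<in> borel_measurable F"
      "f \<in> borel_measurable (restrict_space borel M)"
    and mean: "AE \<omega> in D. c \<omega> \<noteq> 0 \<longrightarrow> integrable (\<kappa> \<omega>) f \<and> m \<omega> = integral\<^sup>L (\<kappa> \<omega>) f"
    and int: "integrable D (\<lambda>\<omega>. c \<omega> * (m \<omega> - f (Y \<omega>)))"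
  shows "(\<integral>\<omega>. c \<omega> * (m \<omega> - f (Y \<omega>)) \<partial>D) = 0"
proof -
  have "(\<integral>\<^sup>+\<omega>. ennreal (c \<omega> * (m \<omega> - f (Y \<omega>))) \<partial>D)
      = (\<integral>\<^sup>+\<omega>. (\<integral>\<^sup>+z. ennreal (c \<omega> * (m \<omega> - f z)) \<partial>\<kappa> \<omega>) \<partial>D)"
    using nn_integral_cond_law[OF D F Y \<kappa> law, of "\<lambda>(\<omega>, z). ennreal (c \<omega> * (m \<omega> - f z))"] by simp
  also have "\<dots> = (\<integral>\<^sup>+\<omega>. (\<integral>\<^sup>+z. ennreal (- (c \<omega> * (m \<omega> - f z))) \<partial>\<kappa> \<omega>) \<partial>D)"
  proof (rule nn_integral_cong_AE)
    show "AE \<omega> in D. (\<integral>\<^sup>+z. ennreal (c \<omega> * (m \<omega> - f z)) \<partial>\<kappa> \<omega>)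
        = (\<integral>\<^sup>+z. ennreal (- (c \<omega> * (m \<omega> - f z))) \<partial>\<kappa> \<omega>)"
      using mean AE_space
    proof eventually_elim
      case (elim \<omega>)
      interpret p: prob_space "\<kappa> \<omega>"
        using measurable_space[OF \<kappa>, of \<omega>] elim(2) F by (auto simp: space_prob_algebra subalgebra_def)
      show ?case
      proof (cases "c \<omega> = 0")
        case False
        with elim show ?thesis
          by (intro nn_integral_pos_eq_neg) (auto simp: p.prob_space)
      qed simp
    qed
  qed
  also have "\<dots> = (\<integral>\<^sup>+\<omega>. ennreal (- (c \<omega> * (m \<omega> - f (Y \<omega>)))) \<partial>D)"
    using nn_integral_cond_law[OF D F Y \<kappa> law, of "\<lambda>(\<omega>, z). ennreal (- (c \<omega> * (m \<omega> - f z)))"] by simp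
  finally show ?thesis
    using int by (simp add: real_lebesgue_integral_def)
qed

lemma integrable_mult_square_integrable:
  fixes f g :: "'a \<Rightarrow> real"
  assumes [measurable]: "f \<in> borel_measurable N" "g \<in> borel_measurable N"
    and "integrable N (\<lambda>z. (f z)\<^sup>2)" "integrable N (\<lambda>z. (g z)\<^sup>2)"
  shows "integrable N (\<lambda>z. f z * g z)"
proof (rule Bochner_Integration.integrable_bound)
  show "integrable N (\<lambda>z. (f z)\<^sup>2 + (g z)\<^sup>2)" using assms by simp
  have "\<bar>a * b\<bar> \<le> \<bar>a\<^sup>2 + b\<^sup>2\<bar>" for a b :: real
  proof -
    have "2 * \<bar>a * b\<bar> \<le> a\<^sup>2 + b\<^sup>2"
      using sum_squares_bound[of "\<bar>a\<bar>" "\<bar>b\<bar>"] by (simp add: abs_mult mult.assoc)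
    then show ?thesis by linarith
  qed
  then show "AE z in N. norm (f z * g z) \<le> norm ((f z)\<^sup>2 + (g z)\<^sup>2)" by auto
qed measurable

lemma integrable_matrix:
  fixes P :: "'a \<Rightarrow> real^'n^'m"
  assumes "\<And>i j. integrable N (\<lambda>\<omega>. P \<omega> $ i $ j)"
  shows "integrable N P"
proof -
  have "P \<omega> = (\<Sum>i\<in>UNIV. \<Sum>j\<in>UNIV. (P \<omega> $ i $ j) *\<^sub>R axis i (axis j 1))" for \<omega>
  proof -
    have "(\<Sum>i\<in>UNIV. \<Sum>j\<in>UNIV. (P \<omega> $ i $ j) *\<^sub>R axis i (axis j 1)) $ k $ l = P \<omega> $ k $ l" for k l
    proof -
      have nth: "(axis i (axis j (1::real)) :: real^'n^'m) $ k $ l = (if i = k \<and> j = l then 1 else 0)" for i j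
        by (auto simp: axis_def)
      have "(\<Sum>i\<in>UNIV. \<Sum>j\<in>UNIV. (P \<omega> $ i $ j) *\<^sub>R axis i (axis j 1)) $ k $ l
          = (\<Sum>i\<in>UNIV. if i = k then (\<Sum>j\<in>UNIV. if j = l then P \<omega> $ i $ j else 0) else 0)"
        unfolding sum_component
        by (intro sum.cong refl) (auto simp: nth simp del: sum.delta sum.delta' intro!: sum.cong)
      then show ?thesis by simp
    qed
    then show ?thesis by (simp add: vec_eq_iff)
  qed
  moreover have "integrable N (\<lambda>\<omega>. \<Sum>i\<in>UNIV. \<Sum>j\<in>UNIV. (P \<omega> $ i $ j) *\<^sub>R axis i (axis j (1::real)) :: real^'n^'m)"
    using assms by (intro Bochner_Integration.integrable_sum integrable_scaleR_left)
  ultimately show ?thesis by presburger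
qed

lemma integral_matrix_nth:
  fixes P :: "'a \<Rightarrow> real^'n^'m"
  assumes "integrable N P"
  shows "integral\<^sup>L N P $ i $ j = (\<integral>\<omega>. P \<omega> $ i $ j \<partial>N)"
  using integral_bounded_linear[OF bounded_linear_compose[OF bounded_linear_vec_nth bounded_linear_vec_nth] assms]
  by metis

lemma orthogonal_average:
  fixes Z :: "nat \<Rightarrow> 'a \<Rightarrow> real"
  assumes T: "T \<ge> 1"
    and meas: "\<And>k. k \<in> {1..T} \<Longrightarrow> Z k \<in> borel_measurable N"
    and sq: "\<And>k. k \<in> {1..T} \<Longrightarrow> integrable N (\<lambda>\<omega>. (Z k \<omega>)\<^sup>2)"
    and bound: "\<And>k. k \<in> {1..T} \<Longrightarrow> (\<integral>\<omega>. (Z k \<omega>)\<^sup>2 \<partial>N) \<le> C"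
    and orth: "\<And>k l. k \<in> {1..T} \<Longrightarrow> l \<in> {1..T} \<Longrightarrow> l < k \<Longrightarrow> (\<integral>\<omega>. Z l \<omega> * Z k \<omega> \<partial>N) = 0"
  shows "integrable N (\<lambda>\<omega>. (1 / real T * (\<Sum>k=1..T. Z k \<omega>))\<^sup>2)" (is ?int)
    and "(\<integral>\<omega>. (1 / real T * (\<Sum>k=1..T. Z k \<omega>))\<^sup>2 \<partial>N) \<le> C * inverse (real T)" (is ?le)
proof -
  have eq: "(1 / real T * (\<Sum>k=1..T. Z k \<omega>))\<^sup>2 = (1 / real T)\<^sup>2 * (\<Sum>k=1..T. \<Sum>l=1..T. Z k \<omega> * Z l \<omega>)" for \<omega>
    by (simp only: power_mult_distrib power2_eq_square[of "\<Sum>k=1..T. Z k \<omega>"] sum_product)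
  have int: "integrable N (\<lambda>\<omega>. Z k \<omega> * Z l \<omega>)" if "k \<in> {1..T}" "l \<in> {1..T}" for k l
    using that by (intro integrable_mult_square_integrable meas sq)
  show ?int
    unfolding eq by (intro integrable_mult_right Bochner_Integration.integrable_sum int)
  have orth': "(\<integral>\<omega>. Z k \<omega> * Z l \<omega> \<partial>N) = (if l = k then \<integral>\<omega>. (Z k \<omega>)\<^sup>2 \<partial>N else 0)"
    if "k \<in> {1..T}" "l \<in> {1..T}" for k l
    using orth[of k l] orth[of l k] that
    by (cases k l rule: linorder_cases) (auto simp: power2_eq_square mult.commute)
  have "(\<integral>\<omega>. (1 / real T * (\<Sum>k=1..T. Z k \<omega>))\<^sup>2 \<partial>N)
      = (1 / real T)\<^sup>2 * (\<Sum>k=1..T. \<Sum>l=1..T. \<integral>\<omega>. Z k \<omega> * Z l \<omega> \<partial>N)"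
    unfolding eq
    by (simp only: integral_mult_right_zero Bochner_Integration.integral_sum Bochner_Integration.integrable_sum int
        cong: sum.cong)
  also have "\<dots> = (1 / real T)\<^sup>2 * (\<Sum>k=1..T. \<integral>\<omega>. (Z k \<omega>)\<^sup>2 \<partial>N)"
    by (simp add: orth')
  also have "\<dots> \<le> (1 / real T)\<^sup>2 * (\<Sum>k=1..T. C)"
    by (intro mult_left_mono sum_mono bound) auto
  also have "\<dots> = C * inverse (real T)"
    using T by (simp add: power2_eq_square field_simps)
  finally show ?le .
qed

lemma matrix_orthogonal_average:
  fixes P Q :: "'a \<Rightarrow> real^'n^'n" and Z :: "'n \<Rightarrow> 'n \<Rightarrow> nat \<Rightarrow> 'a \<Rightarrow> real"
  assumes N: "prob_space N" and T: "T \<ge> 1"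
    and diff: "\<And>i j \<omega>. \<omega> \<in> space N \<Longrightarrow> (P \<omega> - Q \<omega>) $ i $ j = 1 / real T * (\<Sum>k=1..T. Z i j k \<omega>)"
    and P: "\<And>i j. integrable N (\<lambda>\<omega>. P \<omega> $ i $ j)"
    and meas: "\<And>i j k. k \<in> {1..T} \<Longrightarrow> Z i j k \<in> borel_measurable N"
    and sq: "\<And>i j k. k \<in> {1..T} \<Longrightarrow> integrable N (\<lambda>\<omega>. (Z i j k \<omega>)\<^sup>2)"
    and bound: "\<And>i j k. k \<in> {1..T} \<Longrightarrow> (\<integral>\<omega>. (Z i j k \<omega>)\<^sup>2 \<partial>N) \<le> C"
    and mean: "\<And>i j k. k \<in> {1..T} \<Longrightarrow> (\<integral>\<omega>. Z i j k \<omega> \<partial>N) = 0"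
    and orth: "\<And>i j k l. k \<in> {1..T} \<Longrightarrow> l \<in> {1..T} \<Longrightarrow> l < k \<Longrightarrow> (\<integral>\<omega>. Z i j l \<omega> * Z i j k \<omega> \<partial>N) = 0"
  shows "integrable N P \<and> integrable N Q \<and> integral\<^sup>L N P = integral\<^sup>L N Q \<and>
    integrable N (\<lambda>\<omega>. frobenius_sq (P \<omega> - Q \<omega>)) \<and>
    (\<integral>\<omega>. frobenius_sq (P \<omega> - Q \<omega>) \<partial>N) \<le> (real CARD('n))\<^sup>2 * C * inverse (real T)"
proof -
  interpret prob_space N by fact
  let ?A = "\<lambda>i j \<omega>. 1 / real T * (\<Sum>k=1..T. Z i j k \<omega>)"
  have Zint: "integrable N (Z i j k)" if "k \<in> {1..T}" for i j k
    by (rule square_integrable_imp_integrable[OF meas[OF that] sq[OF that]])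
  have A: "integrable N (?A i j)" and A0: "(\<integral>\<omega>. ?A i j \<omega> \<partial>N) = 0" for i j
    using Zint mean by (auto intro!: integrable_mult_right Bochner_Integration.integrable_sum
        simp: Bochner_Integration.integral_sum)
  have PQ: "P \<omega> $ i $ j - ?A i j \<omega> = Q \<omega> $ i $ j" if "\<omega> \<in> space N" for i j \<omega>
    using diff[OF that, of i j] by simp
  have Q: "integrable N (\<lambda>\<omega>. Q \<omega> $ i $ j)" for i j
    using Bochner_Integration.integrable_diff[OF P[of i j] A[of i j]]
    by (rule Bochner_Integration.integrable_cong[OF refl, THEN iffD1, rotated]) (rule PQ)
  have "(\<integral>\<omega>. Q \<omega> $ i $ j \<partial>N) = (\<integral>\<omega>. P \<omega> $ i $ j \<partial>N)" for i j
  proof -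
    have "(\<integral>\<omega>. Q \<omega> $ i $ j \<partial>N) = (\<integral>\<omega>. P \<omega> $ i $ j - ?A i j \<omega> \<partial>N)"
      by (rule Bochner_Integration.integral_cong) (simp_all only: PQ)
    then show ?thesis
      by (simp only: Bochner_Integration.integral_diff[OF P A] A0 diff_zero)
  qed
  then have eq: "integral\<^sup>L N P = integral\<^sup>L N Q"
    by (simp add: vec_eq_iff integral_matrix_nth integrable_matrix P Q)
  note avg = orthogonal_average[OF T, of "Z i j" N C for i j]
  have frob: "frobenius_sq (P \<omega> - Q \<omega>) = (\<Sum>i\<in>UNIV. \<Sum>j\<in>UNIV. (?A i j \<omega>)\<^sup>2)" if "\<omega> \<in> space N" for \<omega>
    unfolding frobenius_sq_def diff[OF that] power2_abs ..
  have int: "integrable N (\<lambda>\<omega>. (?A i j \<omega>)\<^sup>2)" for i j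
    by (rule avg(1)[of i j]) (auto intro: meas sq bound orth)
  have intF: "integrable N (\<lambda>\<omega>. \<Sum>i\<in>UNIV. \<Sum>j\<in>UNIV. (?A i j \<omega>)\<^sup>2)"
    by (intro Bochner_Integration.integrable_sum int)
  have "(\<integral>\<omega>. frobenius_sq (P \<omega> - Q \<omega>) \<partial>N) = (\<integral>\<omega>. (\<Sum>i\<in>UNIV. \<Sum>j\<in>UNIV. (?A i j \<omega>)\<^sup>2) \<partial>N)"
    by (rule Bochner_Integration.integral_cong[OF refl frob])
  also have "\<dots> = (\<Sum>i\<in>UNIV. \<Sum>j\<in>UNIV. \<integral>\<omega>. (?A i j \<omega>)\<^sup>2 \<partial>N)"
    by (simp only: Bochner_Integration.integral_sum Bochner_Integration.integrable_sum int)
  also have "\<dots> \<le> (\<Sum>i\<in>(UNIV::'n set). \<Sum>j\<in>(UNIV::'n set). C * inverse (real T))"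
    by (intro sum_mono avg(2)) (auto intro: meas sq bound orth)
  also have "\<dots> = (real CARD('n))\<^sup>2 * C * inverse (real T)"
    by (simp add: power2_eq_square)
  finally have "(\<integral>\<omega>. frobenius_sq (P \<omega> - Q \<omega>) \<partial>N) \<le> (real CARD('n))\<^sup>2 * C * inverse (real T)" .
  moreover have "integrable N (\<lambda>\<omega>. frobenius_sq (P \<omega> - Q \<omega>))"
    using intF by (subst Bochner_Integration.integrable_cong[OF refl frob])
  ultimately show ?thesis
    using eq P Q by (auto intro: integrable_matrix)
qed

locale koopman_kernel =
  fixes \<Omega> :: "'o measure" and M :: "real set" and X :: "real \<Rightarrow> real \<Rightarrow> 'o \<Rightarrow> real" and t :: real
  assumes flow_measurable: "x \<in> M \<Longrightarrow> X t x \<in> \<Omega> \<rightarrow>\<^sub>M restrict_space borel M"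
    and law_measurable:
      "transition_law \<Omega> M X t \<in> restrict_space borel M \<rightarrow>\<^sub>M prob_algebra (restrict_space borel M)"
begin

abbreviation (input) "S \<equiv> restrict_space (borel :: real measure) M"
abbreviation (input) "\<kappa> \<equiv> transition_law \<Omega> M X t"

lemma koopman_eq:
  assumes "x \<in> M" "f \<in> borel_measurable S"
  shows "koopman \<Omega> X t f x = integral\<^sup>L (\<kappa> x) f"
  unfolding koopman_def transition_law_def using assms by (simp add: integral_distr flow_measurable)

lemma koopman_measurable:
  assumes [measurable]: "f \<in> borel_measurable S"
  shows "koopman \<Omega> X t f \<in> borel_measurable S"
proof -
  note [measurable] = measurable_prob_algebraD[OF law_measurable]
  have "(\<lambda>x. integral\<^sup>L (\<kappa> x) f) \<in> borel_measurable S" by measurable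
  then show ?thesis
    by (rule measurable_cong[THEN iffD1, rotated]) (simp add: koopman_eq space_restrict_space)
qed

lemma koopman_var_eq:
  assumes "x \<in> M" and [measurable]: "f \<in> borel_measurable S"
  shows "koopman_var \<Omega> X t f x = (\<integral>\<^sup>+z. ennreal ((f z - koopman \<Omega> X t f x)\<^sup>2) \<partial>\<kappa> x)"
  unfolding koopman_var_def transition_law_def using assms(1) by (simp add: nn_integral_distr flow_measurable)

lemma koopman_var_measurable:
  assumes [measurable]: "f \<in> borel_measurable S"
  shows "koopman_var \<Omega> X t f \<in> borel_measurable S"
proof -
  note [measurable] = koopman_measurable[OF assms]
  have "(\<lambda>x. \<integral>\<^sup>+z. ennreal ((f z - koopman \<Omega> X t f x)\<^sup>2) \<partial>\<kappa> x) \<in> borel_measurable S"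
    by (rule nn_integral_measurable_subprob_algebra2[OF _ measurable_prob_algebraD[OF law_measurable]]) simp
  then show ?thesis
    by (rule measurable_cong[THEN iffD1, rotated]) (simp add: koopman_var_eq space_restrict_space)
qed

lemma integrable_if_koopman_var_finite:
  assumes x: "x \<in> M" and f [measurable]: "f \<in> borel_measurable S" and fin: "koopman_var \<Omega> X t f x \<noteq> \<infinity>"
  shows "integrable (\<kappa> x) f"
proof -
  interpret p: prob_space "\<kappa> x"
    using measurable_space[OF law_measurable, of x] x by (auto simp: space_prob_algebra space_restrict_space)
  have s [measurable_cong, simp]: "sets (\<kappa> x) = sets S" by (simp add: transition_law_def)
  let ?m = "koopman \<Omega> X t f x"
  have "integrable (\<kappa> x) (\<lambda>z. (f z - ?m)\<^sup>2)"
    using fin koopman_var_eq[OF x f] by (intro integrableI_nonneg) (auto simp: less_top)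
  then have "integrable (\<kappa> x) (\<lambda>z. f z - ?m)"
    by (rule p.square_integrable_imp_integrable[rotated]) measurable
  then have "integrable (\<kappa> x) (\<lambda>z. (f z - ?m) + ?m)"
    by (intro Bochner_Integration.integrable_add) auto
  then show ?thesis by simp
qed

text \<open>
  Almost surely where \<open>g(u) \<noteq> 0\<close>, the variance of \<open>f\<close> is finite, which forces \<open>f\<close> to be integrable against
  the transition law, so that \<open>koopman\<close> is a genuine expectation there.
\<close>

lemma error_summand:
  fixes u v :: "'w \<Rightarrow> real"
  assumes D: "prob_space D" and F: "subalgebra D F"
    and u [measurable]: "u \<in> F \<rightarrow>\<^sub>M S" and v [measurable]: "v \<in> D \<rightarrow>\<^sub>M S"
    and law: "has_cond_law D F v (\<lambda>\<omega>. \<kappa> (u \<omega>)) M"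
    and f [measurable]: "f \<in> borel_measurable S" and g [measurable]: "g \<in> borel_measurable S"
    and C: "0 \<le> C"
    and bound: "(\<integral>\<^sup>+\<omega>. ennreal ((g (u \<omega>))\<^sup>2) * koopman_var \<Omega> X t f (u \<omega>) \<partial>D) \<le> ennreal C"
  defines "Z \<equiv> \<lambda>\<omega>. (koopman \<Omega> X t f (u \<omega>) - f (v \<omega>)) * g (u \<omega>)"
  shows error_measurable: "Z \<in> borel_measurable D"
    and error_square_integrable: "integrable D (\<lambda>\<omega>. (Z \<omega>)\<^sup>2)"
    and error_second_moment: "(\<integral>\<omega>. (Z \<omega>)\<^sup>2 \<partial>D) \<le> C"
    and error_orthogonal: "\<And>H :: 'w \<Rightarrow> real. H \<in> borel_measurable F \<Longrightarrow> integrable D (\<lambda>\<omega>. (H \<omega>)\<^sup>2) \<Longrightarrow>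
          (\<integral>\<omega>. H \<omega> * Z \<omega> \<partial>D) = 0"
proof -
  note [measurable] = koopman_measurable[OF f] koopman_var_measurable[OF f]
  note uD [measurable] = measurable_from_subalg[OF F u]
  have \<kappa>u: "(\<lambda>\<omega>. \<kappa> (u \<omega>)) \<in> F \<rightarrow>\<^sub>M prob_algebra S"
    by (rule measurable_compose[OF u law_measurable])
  have uM: "u \<omega> \<in> M" if "\<omega> \<in> space D" for \<omega>
    using measurable_space[OF uD that] by (simp add: space_restrict_space)
  show Z [measurable]: "Z \<in> borel_measurable D"
    unfolding Z_def by measurable
  have "(\<integral>\<^sup>+\<omega>. ennreal ((Z \<omega>)\<^sup>2) \<partial>D)
      = (\<integral>\<^sup>+\<omega>. (\<integral>\<^sup>+z. ennreal (((koopman \<Omega> X t f (u \<omega>) - f z) * g (u \<omega>))\<^sup>2) \<partial>\<kappa> (u \<omega>)) \<partial>D)"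
    unfolding Z_def
    using nn_integral_cond_law[OF D F v \<kappa>u law,
        of "\<lambda>(\<omega>, z). ennreal (((koopman \<Omega> X t f (u \<omega>) - f z) * g (u \<omega>))\<^sup>2)"] by simp
  also have "\<dots> = (\<integral>\<^sup>+\<omega>. ennreal ((g (u \<omega>))\<^sup>2) * koopman_var \<Omega> X t f (u \<omega>) \<partial>D)"
  proof (intro nn_integral_cong)
    fix \<omega> assume "\<omega> \<in> space D"
    note x = uM[OF this]
    have [measurable_cong]: "sets (\<kappa> (u \<omega>)) = sets S" by (simp add: transition_law_def)
    have "(\<integral>\<^sup>+z. ennreal (((koopman \<Omega> X t f (u \<omega>) - f z) * g (u \<omega>))\<^sup>2) \<partial>\<kappa> (u \<omega>))
        = (\<integral>\<^sup>+z. ennreal ((g (u \<omega>))\<^sup>2) * ennreal ((f z - koopman \<Omega> X t f (u \<omega>))\<^sup>2) \<partial>\<kappa> (u \<omega>))"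
      by (intro nn_integral_cong) (simp add: ennreal_mult[symmetric] power_mult_distrib power2_commute mult.commute)
    also have "\<dots> = ennreal ((g (u \<omega>))\<^sup>2) * koopman_var \<Omega> X t f (u \<omega>)"
      unfolding koopman_var_eq[OF x f] by (rule nn_integral_cmult) measurable
    finally show "(\<integral>\<^sup>+z. ennreal (((koopman \<Omega> X t f (u \<omega>) - f z) * g (u \<omega>))\<^sup>2) \<partial>\<kappa> (u \<omega>)) = \<dots>" .
  qed
  also note bound
  finally have Z2: "(\<integral>\<^sup>+\<omega>. ennreal ((Z \<omega>)\<^sup>2) \<partial>D) \<le> ennreal C" .
  show sq: "integrable D (\<lambda>\<omega>. (Z \<omega>)\<^sup>2)"
    using Z2 by (intro integrableI_nonneg) (auto intro: le_less_trans)
  show "(\<integral>\<omega>. (Z \<omega>)\<^sup>2 \<partial>D) \<le> C"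
    using Z2 C by (subst (asm) nn_integral_eq_integral[OF sq]) auto
  fix H :: "'w \<Rightarrow> real" assume H [measurable]: "H \<in> borel_measurable F" and H2: "integrable D (\<lambda>\<omega>. (H \<omega>)\<^sup>2)"
  have eq: "H \<omega> * Z \<omega> = (H \<omega> * g (u \<omega>)) * (koopman \<Omega> X t f (u \<omega>) - f (v \<omega>))" for \<omega>
    by (simp add: Z_def)
  have int: "integrable D (\<lambda>\<omega>. H \<omega> * Z \<omega>)"
    by (rule integrable_mult_square_integrable[OF measurable_from_subalg[OF F H] Z H2 sq])
  have "AE \<omega> in D. ennreal ((g (u \<omega>))\<^sup>2) * koopman_var \<Omega> X t f (u \<omega>) \<noteq> \<infinity>"
    using bound by (intro nn_integral_PInf_AE) (auto simp: top_unique)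
  then have mean: "AE \<omega> in D. H \<omega> * g (u \<omega>) \<noteq> 0 \<longrightarrow>
      integrable (\<kappa> (u \<omega>)) f \<and> koopman \<Omega> X t f (u \<omega>) = integral\<^sup>L (\<kappa> (u \<omega>)) f"
    using AE_space
    by eventually_elim
       (auto intro!: integrable_if_koopman_var_finite koopman_eq uM f simp: ennreal_mult_eq_top_iff)
  show "(\<integral>\<omega>. H \<omega> * Z \<omega> \<partial>D) = 0"
    unfolding eq by (rule integral_cond_law_centered[OF D F v \<kappa>u law _ _ f mean]) (use int in \<open>simp_all add: eq\<close>)
qed

lemma error_matrix_nth:
  "(K_mu \<Omega> X t \<psi> T x \<omega> - K_hat \<psi> T x y \<omega>) $ i $ j
    = 1 / real T * (\<Sum>k=1..T. (koopman \<Omega> X t (\<psi> i) (x k \<omega>) - \<psi> i (y k \<omega>)) * \<psi> j (x k \<omega>))"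
  by (simp add: K_mu_def K_hat_def avg_mult_transpose_def left_diff_distrib sum_subtractf right_diff_distrib)

lemma iid_sampling_error:
  fixes \<psi> :: "'n::finite \<Rightarrow> real \<Rightarrow> real" and x y :: "nat \<Rightarrow> 'w \<Rightarrow> real"
  assumes samp: "iid_sampling \<Omega> M X t \<mu> T D x y" and T: "T \<ge> 1" and C: "0 \<le> C"
    and \<psi>: "\<And>i. \<psi> i \<in> borel_measurable S"
    and bound: "\<And>i j. (\<integral>\<^sup>+z. ennreal ((\<psi> j z)\<^sup>2) * koopman_var \<Omega> X t (\<psi> i) z \<partial>\<mu>) \<le> ennreal C"
    and K: "\<And>i j. integrable \<mu> (\<lambda>z. koopman \<Omega> X t (\<psi> i) z * \<psi> j z)"
  defines "P \<equiv> K_mu \<Omega> X t \<psi> T x" and "Q \<equiv> K_hat \<psi> T x y"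
  shows "integrable D P \<and> integrable D Q \<and> integral\<^sup>L D P = integral\<^sup>L D Q \<and>
    integrable D (\<lambda>\<omega>. frobenius_sq (P \<omega> - Q \<omega>)) \<and>
    (\<integral>\<omega>. frobenius_sq (P \<omega> - Q \<omega>) \<partial>D) \<le> (real CARD('n))\<^sup>2 * C * inverse (real T)"
proof -
  from samp have D: "prob_space D"
    and x: "\<And>k. k \<in> {1..T} \<Longrightarrow> x k \<in> D \<rightarrow>\<^sub>M S"
    and y: "\<And>k. k \<in> {1..T} \<Longrightarrow> y k \<in> D \<rightarrow>\<^sub>M S"
    and \<mu>: "\<And>k. k \<in> {1..T} \<Longrightarrow> distr D S (x k) = \<mu>"
    and law: "\<And>k. k \<in> {1..T} \<Longrightarrow>
      has_cond_law D (vimage_algebra (space D) (x k) S) (y k) (\<lambda>\<omega>. \<kappa> (x k \<omega>)) M"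
    and indep: "prob_space.indep_vars D (\<lambda>_. S \<Otimes>\<^sub>M S) (\<lambda>k \<omega>. (x k \<omega>, y k \<omega>)) {1..T}"
    unfolding iid_sampling_def by auto
  interpret prob_space D by fact
  let ?\<zeta> = "\<lambda>i j p. (koopman \<Omega> X t (\<psi> i) (fst p) - \<psi> i (snd p)) * \<psi> j (fst p)"
  let ?Z = "\<lambda>i j k \<omega>. (koopman \<Omega> X t (\<psi> i) (x k \<omega>) - \<psi> i (y k \<omega>)) * \<psi> j (x k \<omega>)"
  note [measurable] = \<psi> koopman_measurable[OF \<psi>] koopman_var_measurable[OF \<psi>]
  have F: "subalgebra D (vimage_algebra (space D) (x k) S)" if "k \<in> {1..T}" for k
    using sets_image_in_sets[OF refl x[OF that]] by (simp add: subalgebra_def)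
  have xF: "x k \<in> vimage_algebra (space D) (x k) S \<rightarrow>\<^sub>M S" if "k \<in> {1..T}" for k
    by (rule measurable_vimage_algebra1) (use measurable_space[OF x[OF that]] in auto)
  have bound': "(\<integral>\<^sup>+\<omega>. ennreal ((\<psi> j (x k \<omega>))\<^sup>2) * koopman_var \<Omega> X t (\<psi> i) (x k \<omega>) \<partial>D) \<le> ennreal C"
    if "k \<in> {1..T}" for i j k
    using bound[where i=i and j=j] unfolding \<mu>[OF that, symmetric] by (subst (asm) nn_integral_distr[OF x[OF that]]) auto
  note summand = error_summand[OF D F xF y law \<psi> \<psi> C bound']
  have sq: "integrable D (\<lambda>\<omega>. (?Z i j k \<omega>)\<^sup>2)" if "k \<in> {1..T}" for i j k
    by (rule summand(2)) (use that in auto)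
  have meas: "?Z i j k \<in> borel_measurable D" if "k \<in> {1..T}" for i j k
    by (rule summand(1)) (use that in auto)
  have mean: "(\<integral>\<omega>. ?Z i j k \<omega> \<partial>D) = 0" if "k \<in> {1..T}" for i j k
    using summand(4)[OF that that that that that, of "\<lambda>_. 1"] by simp
  show ?thesis
    unfolding P_def Q_def
  proof (rule matrix_orthogonal_average[where Z="?Z", OF D T _ _ meas sq _ mean])
    fix i j :: 'n
    show "(K_mu \<Omega> X t \<psi> T x \<omega> - K_hat \<psi> T x y \<omega>) $ i $ j = 1 / real T * (\<Sum>k=1..T. ?Z i j k \<omega>)" for \<omega>
      by (rule error_matrix_nth)
    show "integrable D (\<lambda>\<omega>. K_mu \<Omega> X t \<psi> T x \<omega> $ i $ j)"
      unfolding K_mu_def avg_mult_transpose_def vec_lambda_beta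
    proof (intro integrable_mult_right Bochner_Integration.integrable_sum)
      fix k assume k: "k \<in> {1..T}"
      show "integrable D (\<lambda>\<omega>. koopman \<Omega> X t (\<psi> i) (x k \<omega>) * \<psi> j (x k \<omega>))"
        using K[of i j] unfolding \<mu>[OF k, symmetric] by (rule integrable_distr[OF x[OF k]])
    qed
  next
    fix i j :: 'n and k assume "k \<in> {1..T}"
    then show "(\<integral>\<omega>. (?Z i j k \<omega>)\<^sup>2 \<partial>D) \<le> C"
      by (intro summand(3)) auto
  next
    fix i j :: 'n and k l assume k: "k \<in> {1..T}" and l: "l \<in> {1..T}" and "l < k"
    have "indep_vars (\<lambda>_. borel) (?Z i j) {l, k}"
      using indep_vars_compose2[OF indep_vars_subset[OF indep], of "{l, k}" "\<lambda>_. ?\<zeta> i j" "\<lambda>_. borel"] k l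
      by simp
    then have "(\<integral>\<omega>. (\<Prod>m\<in>{l, k}. ?Z i j m \<omega>) \<partial>D) = (\<Prod>m\<in>{l, k}. \<integral>\<omega>. ?Z i j m \<omega> \<partial>D)"
      using k l by (intro indep_vars_lebesgue_integral) (auto intro!: square_integrable_imp_integrable[OF meas sq])
    then show "(\<integral>\<omega>. ?Z i j l \<omega> * ?Z i j k \<omega> \<partial>D) = 0"
      using \<open>l < k\<close> mean[OF l, of i j] by simp
  qed
qed

lemma markov_sampling_error:
  fixes \<psi> :: "'n::finite \<Rightarrow> real \<Rightarrow> real" and x y :: "nat \<Rightarrow> 'w \<Rightarrow> real"
  assumes samp: "markov_sampling \<Omega> M X t x1 T D x y" and T: "T \<ge> 1" and C: "0 \<le> C"
    and \<psi>: "\<And>i. \<psi> i \<in> borel_measurable S"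
    and bound: "\<And>i j k. k \<in> {1..T} \<Longrightarrow>
      (\<integral>\<^sup>+\<omega>. ennreal ((\<psi> j (x k \<omega>))\<^sup>2) * koopman_var \<Omega> X t (\<psi> i) (x k \<omega>) \<partial>D) \<le> ennreal C"
  defines "P \<equiv> K_mu \<Omega> X t \<psi> T x" and "Q \<equiv> K_hat \<psi> T x y"
  assumes K: "\<And>i j. integrable D (\<lambda>\<omega>. P \<omega> $ i $ j)"
  shows "integrable D P \<and> integrable D Q \<and> integral\<^sup>L D P = integral\<^sup>L D Q \<and>
    integrable D (\<lambda>\<omega>. frobenius_sq (P \<omega> - Q \<omega>)) \<and>
    (\<integral>\<omega>. frobenius_sq (P \<omega> - Q \<omega>) \<partial>D) \<le> (real CARD('n))\<^sup>2 * C * inverse (real T)"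
proof -
  define F where
    "F k = vimage_algebra (space D) (\<lambda>\<omega>. \<lambda>i\<in>{1..k}. x i \<omega>) (\<Pi>\<^sub>M i\<in>{1..k}. S)" for k :: nat
  from samp have D: "prob_space D"
    and x: "\<And>k. k \<in> {1..T+1} \<Longrightarrow> x k \<in> D \<rightarrow>\<^sub>M S"
    and law: "\<And>k. k \<in> {1..T} \<Longrightarrow> has_cond_law D (F k) (x (k + 1)) (\<lambda>\<omega>. \<kappa> (x k \<omega>)) M"
    and y: "\<And>k \<omega>. k \<in> {1..T} \<Longrightarrow> \<omega> \<in> space D \<Longrightarrow> y k \<omega> = x (k + 1) \<omega>"
    unfolding markov_sampling_def F_def by auto
  interpret prob_space D by fact
  let ?Z = "\<lambda>i j k \<omega>. (koopman \<Omega> X t (\<psi> i) (x k \<omega>) - \<psi> i (x (k + 1) \<omega>)) * \<psi> j (x k \<omega>)"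
  note [measurable] = \<psi> koopman_measurable[OF \<psi>]
  have path: "(\<lambda>\<omega>. \<lambda>i\<in>{1..k}. x i \<omega>) \<in> D \<rightarrow>\<^sub>M (\<Pi>\<^sub>M i\<in>{1..k}. S)" if "k \<in> {1..T}" for k
    using that by (intro measurable_restrict x) auto
  have F: "subalgebra D (F k)" if "k \<in> {1..T}" for k
    using sets_image_in_sets[OF refl path[OF that]] by (simp add: subalgebra_def F_def)
  have xF: "x l \<in> F k \<rightarrow>\<^sub>M S" if "k \<in> {1..T}" "l \<in> {1..k}" for k l
  proof -
    have "(\<lambda>\<omega>. \<lambda>i\<in>{1..k}. x i \<omega>) \<in> F k \<rightarrow>\<^sub>M (\<Pi>\<^sub>M i\<in>{1..k}. S)"
      unfolding F_def
      by (rule measurable_vimage_algebra1) (use measurable_space[OF path[OF that(1)]] in auto)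
    from measurable_compose[OF this measurable_component_singleton[OF that(2)]] that(2)
    show ?thesis by simp
  qed
  have xk: "x k \<in> F k \<rightarrow>\<^sub>M S" if "k \<in> {1..T}" for k
    using xF[OF that, of k] that by simp
  have xSuc: "x (k + 1) \<in> D \<rightarrow>\<^sub>M S" if "k \<in> {1..T}" for k
    using that by (intro x) auto
  note summand = error_summand[OF D F xk xSuc law \<psi> \<psi> C bound]
  have sq: "integrable D (\<lambda>\<omega>. (?Z i j k \<omega>)\<^sup>2)" if "k \<in> {1..T}" for i j k
    by (rule summand(2)) (use that in auto)
  have meas: "?Z i j k \<in> borel_measurable D" if "k \<in> {1..T}" for i j k
    by (rule summand(1)) (use that in auto)
  have mean: "(\<integral>\<omega>. ?Z i j k \<omega> \<partial>D) = 0" if "k \<in> {1..T}" for i j k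
    using summand(4)[OF that that that that that, of "\<lambda>_. 1"] by simp
  show ?thesis
  proof (rule matrix_orthogonal_average[OF D T _ K meas sq _ mean])
    fix i j \<omega> assume "\<omega> \<in> space D"
    then show "(P \<omega> - Q \<omega>) $ i $ j = 1 / real T * (\<Sum>k=1..T. ?Z i j k \<omega>)"
      unfolding P_def Q_def error_matrix_nth by (simp add: y)
  next
    fix i j :: 'n and k assume "k \<in> {1..T}"
    then show "(\<integral>\<omega>. (?Z i j k \<omega>)\<^sup>2 \<partial>D) \<le> C"
      by (intro summand(3)) auto
  next
    fix i j :: 'n and k l assume k: "k \<in> {1..T}" and l: "l \<in> {1..T}" and "l < k"
    then have [measurable]: "x l \<in> F k \<rightarrow>\<^sub>M S" "x (l + 1) \<in> F k \<rightarrow>\<^sub>M S"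
      by (auto intro!: xF)
    have "?Z i j l \<in> borel_measurable (F k)" by measurable
    then show "(\<integral>\<omega>. ?Z i j l \<omega> * ?Z i j k \<omega> \<partial>D) = 0"
      using k sq[OF l] by (intro summand(4))
  qed
qed

end

lemma sets_brownian_filtration_subset:
  assumes W: "brownian_motion \<Omega> W"
  shows "sets (brownian_filtration \<Omega> W s) \<subseteq> sets \<Omega>"
proof -
  let ?G = "{W r -` A \<inter> space \<Omega> | r A. 0 \<le> r \<and> r \<le> s \<and> A \<in> sets borel} \<union> null_sets \<Omega>"
  have G: "?G \<subseteq> sets \<Omega>"
    using W by (auto simp: brownian_motion_def intro: measurable_sets)
  then have "?G \<subseteq> Pow (space \<Omega>)"
    using sets.sets_into_space by blast
  then show ?thesis
    unfolding brownian_filtration_def using sets.sigma_sets_subset[OF G] by simp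
qed

lemma koopman_kernelI:
  assumes sde: "sde_solutions \<Omega> W M a b \<theta> X" and t: "0 \<le> t"
    and kernel: "transition_law \<Omega> M X t \<in> restrict_space borel M \<rightarrow>\<^sub>M prob_algebra (restrict_space borel M)"
  shows "koopman_kernel \<Omega> M X t"
proof (rule koopman_kernel.intro)
  from sde have W: "brownian_motion \<Omega> W" by (simp add: sde_solutions_def)
  show "X t x \<in> \<Omega> \<rightarrow>\<^sub>M restrict_space borel M" if "x \<in> M" for x
  proof (rule measurable_from_subalg)
    show "subalgebra \<Omega> (brownian_filtration \<Omega> W t)"
      using sets_brownian_filtration_subset[OF W]
      by (simp add: subalgebra_def brownian_filtration_def space_measure_of_conv)
    show "X t x \<in> brownian_filtration \<Omega> W t \<rightarrow>\<^sub>M restrict_space borel M"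
      using sde that t by (simp add: sde_solutions_def strong_solution_def)
  qed
qed (rule kernel)

lemma koopman_product_integrable:
  assumes V: "koopman_invariant_L2_subspace \<Omega> X \<mu> V" and t: "0 \<le> t" and fg: "f \<in> V" "g \<in> V"
    and K: "koopman \<Omega> X t f \<in> borel_measurable \<mu>"
  shows "integrable \<mu> (\<lambda>z. koopman \<Omega> X t f z * g z)"
proof -
  from V t fg(1) obtain h where h: "h \<in> V" and eq: "AE z in \<mu>. koopman \<Omega> X t f z = h z"
    unfolding koopman_invariant_L2_subspace_def by blast
  have L2: "p \<in> borel_measurable \<mu>" "integrable \<mu> (\<lambda>z. (p z)\<^sup>2)" if "p \<in> V" for p
    using V that unfolding koopman_invariant_L2_subspace_def by blast+
  note [measurable] = L2(1)[OF fg(2)] L2(1)[OF h] K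
  have "integrable \<mu> (\<lambda>z. h z * g z)"
    by (intro integrable_mult_square_integrable L2 h fg(2))
  then show ?thesis
    by (rule integrable_cong_AE[THEN iffD1, rotated -1]) (use eq in \<open>auto elim: eventually_mono\<close>)
qed

theorem proposition2p6:
  fixes \<Omega> :: "'o measure" and W :: "real \<Rightarrow> 'o \<Rightarrow> real"
    and M :: "real set"
    and a b :: "real \<Rightarrow> 'p \<Rightarrow> real" and \<theta> :: 'p
    and X :: "real \<Rightarrow> real \<Rightarrow> 'o \<Rightarrow> real"
    and \<mu> :: "real measure"
    and V :: "(real \<Rightarrow> real) set"
    and \<psi> :: "'n::finite \<Rightarrow> real \<Rightarrow> real"
    and t \<gamma>' x1 :: real
    and D :: "nat \<Rightarrow> 'w measure"
    and x y :: "nat \<Rightarrow> nat \<Rightarrow> 'w \<Rightarrow> real"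
  assumes sde: "sde_solutions \<Omega> W M a b \<theta> X"
    and kernel: "\<And>s. s \<ge> 0 \<Longrightarrow>
      transition_law \<Omega> M X s \<in> restrict_space borel M \<rightarrow>\<^sub>M prob_algebra (restrict_space borel M)"
    and mu: "prob_space \<mu>" "sets \<mu> = sets (restrict_space borel M)"
    and V: "koopman_invariant_L2_subspace \<Omega> X \<mu> V"
    and psi: "\<And>i. \<psi> i \<in> V" "lin_indep_on M \<psi>"
    and t: "t > 0"
    and gamma': "\<gamma>' > 0"
    and data:
      "((\<forall>T\<ge>1. iid_sampling \<Omega> M X t \<mu> T (D T) (x T) (y T)) \<and>
        (\<forall>i j. (\<integral>\<^sup>+z. ennreal ((\<psi> j z)\<^sup>2) * koopman_var \<Omega> X t (\<psi> i) z \<partial>\<mu>) \<le> ennreal \<gamma>'))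
       \<or>
       ((\<forall>T\<ge>1. markov_sampling \<Omega> M X t x1 T (D T) (x T) (y T)) \<and>
        (\<forall>T\<ge>1. \<forall>k\<in>{1..T}. \<forall>i j.
           (\<integral>\<^sup>+\<omega>. ennreal ((\<psi> j (x T k \<omega>))\<^sup>2) * koopman_var \<Omega> X t (\<psi> i) (x T k \<omega>) \<partial>D T)
             \<le> ennreal \<gamma>') \<and>
        (\<forall>T\<ge>1. \<forall>i j. integrable (D T) (\<lambda>\<omega>. K_mu \<Omega> X t \<psi> T (x T) \<omega> $ i $ j) \<and>
                     integrable (D T) (\<lambda>\<omega>. K_hat \<psi> T (x T) (y T) \<omega> $ i $ j)))"
  shows "(\<forall>T\<ge>1.
            integrable (D T) (K_mu \<Omega> X t \<psi> T (x T)) \<and>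
            integrable (D T) (K_hat \<psi> T (x T) (y T)) \<and>
            (\<integral>\<omega>. K_mu \<Omega> X t \<psi> T (x T) \<omega> \<partial>D T) = (\<integral>\<omega>. K_hat \<psi> T (x T) (y T) \<omega> \<partial>D T)) \<and>
         (\<exists>\<gamma>>0. \<forall>T\<ge>1.
            integrable (D T) (\<lambda>\<omega>. frobenius_sq (K_mu \<Omega> X t \<psi> T (x T) \<omega> - K_hat \<psi> T (x T) (y T) \<omega>)) \<and>
            (\<integral>\<omega>. frobenius_sq (K_mu \<Omega> X t \<psi> T (x T) \<omega> - K_hat \<psi> T (x T) (y T) \<omega>) \<partial>D T)
              \<le> \<gamma> * inverse (real T))"
proof -
  interpret koopman_kernel \<Omega> M X t
    using sde t by (intro koopman_kernelI kernel) auto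
  have psi_meas: "\<psi> i \<in> borel_measurable (restrict_space borel M)" for i
    using V psi(1)[of i] measurable_cong_sets[OF mu(2) refl, of borel]
    unfolding koopman_invariant_L2_subspace_def by blast
  have K: "integrable \<mu> (\<lambda>z. koopman \<Omega> X t (\<psi> i) z * \<psi> j z)" for i j
    by (rule koopman_product_integrable[OF V _ psi(1) psi(1)])
       (use t koopman_measurable[OF psi_meas[of i]] in \<open>auto simp: measurable_cong_sets[OF mu(2) refl]\<close>)
  define \<gamma> where "\<gamma> = (real CARD('n))\<^sup>2 * \<gamma>'"
  have "\<gamma> > 0"
    unfolding \<gamma>_def using gamma' by simp
  have main: "integrable (D T) (K_mu \<Omega> X t \<psi> T (x T)) \<and>
      integrable (D T) (K_hat \<psi> T (x T) (y T)) \<and>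
      (\<integral>\<omega>. K_mu \<Omega> X t \<psi> T (x T) \<omega> \<partial>D T) = (\<integral>\<omega>. K_hat \<psi> T (x T) (y T) \<omega> \<partial>D T) \<and>
      integrable (D T) (\<lambda>\<omega>. frobenius_sq (K_mu \<Omega> X t \<psi> T (x T) \<omega> - K_hat \<psi> T (x T) (y T) \<omega>)) \<and>
      (\<integral>\<omega>. frobenius_sq (K_mu \<Omega> X t \<psi> T (x T) \<omega> - K_hat \<psi> T (x T) (y T) \<omega>) \<partial>D T)
        \<le> \<gamma> * inverse (real T)" if T: "T \<ge> 1" for T
    using data
  proof
    assume "(\<forall>T\<ge>1. iid_sampling \<Omega> M X t \<mu> T (D T) (x T) (y T)) \<and>
        (\<forall>i j. (\<integral>\<^sup>+z. ennreal ((\<psi> j z)\<^sup>2) * koopman_var \<Omega> X t (\<psi> i) z \<partial>\<mu>) \<le> ennreal \<gamma>')"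
    with T gamma' show ?thesis
      unfolding \<gamma>_def by (intro iid_sampling_error[where \<mu>=\<mu>] psi_meas K) auto
  next
    assume "(\<forall>T\<ge>1. markov_sampling \<Omega> M X t x1 T (D T) (x T) (y T)) \<and>
        (\<forall>T\<ge>1. \<forall>k\<in>{1..T}. \<forall>i j.
           (\<integral>\<^sup>+\<omega>. ennreal ((\<psi> j (x T k \<omega>))\<^sup>2) * koopman_var \<Omega> X t (\<psi> i) (x T k \<omega>) \<partial>D T)
             \<le> ennreal \<gamma>') \<and>
        (\<forall>T\<ge>1. \<forall>i j. integrable (D T) (\<lambda>\<omega>. K_mu \<Omega> X t \<psi> T (x T) \<omega> $ i $ j) \<and>
                     integrable (D T) (\<lambda>\<omega>. K_hat \<psi> T (x T) (y T) \<omega> $ i $ j))"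
    with T gamma' show ?thesis
      unfolding \<gamma>_def by (intro markov_sampling_error psi_meas) auto
  qed
  show ?thesis
    by (intro conjI allI impI exI[of _ \<gamma>] \<open>\<gamma> > 0\<close>) (use main in \<open>simp_all only:\<close>)
qed

end
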